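(* Let $|H_n^{n-1}\rangle=\prod_{i=1}^{n} C^{\{1,\dots,n\}\setminus\{i\}}\,|+\rangle^{\otimes n}$ be the $n$-qubit hypergraph state endowed with all possible hyperedges of cardinality $n-1$ (and no others). Then the maximum squared overlap between $|H_n^{n-1}\rangle$ and the pure biseparable states is $$\alpha(|H_4^3\rangle)=\frac{3+\sqrt5}{8}\le\frac34,$$ $$\alpha(|H_n^{n-1}\rangle)=\frac{2^{n-1}-n}{2^{n-1}}\quad\text{for } n \text{ even},\ n\ge 6,$$ $$\alpha(|H_n^{n-1}\rangle)=\frac{2^{n-1}-n+1}{2^{n-1}}\quad\text{for } n \text{ odd}.$$ The multipartite entanglement of $|H_n^{n-1}\rangle$ is therefore $$E(|H_4^3\rangle)=\frac{5-\sqrt5}{8}\ge\frac14,$$ $$E(|H_n^{n-1}\rangle)=\frac{n}{2^{n-1}}\quad\text{for } n \text{ even},\ n\ge 6,$$ $$E(|H_n^{n-1}\rangle)=\frac{n-1}{2^{n-1}}\quad\text{for } n \text{ odd}.$$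
   Context: Throughout, $n\ge 2$ is the number of qubits, so the Hilbert space is $(\mathbb{C}^2)^{\otimes n}$ with computational basis $|x\rangle$, $x\in\{0,1\}^n$, and $|+\rangle=(|0\rangle+|1\rangle)/\sqrt2$. For a nonempty set $e\subseteq\{1,\dots,n\}$ with $|e|=k$, $C^{e}=C_k^{e}$ is the $k$-qubit controlled-$Z$ gate acting on the qubits in $e$ (identity on the other qubits): it is the diagonal operator with $C^e|x\rangle=-|x\rangle$ if $x_j=1$ for all $j\in e$, and $C^e|x\rangle=|x\rangle$ otherwise (for $k=1$ it is the Pauli matrix $\sigma_z$ on that qubit). All these gates commute. Overlap and multipartite entanglement: for a normalized pure state $|\psi\rangle$ of $n$ qubits and a bipartition $A\,|\,B$ of the set of qubits into two nonempty disjoint sets with union $\{1,\dots,n\}$, let $\alpha^{AB}(|\psi\rangle)=\max|\langle\phi^A|\langle\phi^B|\psi\rangle|^2$, the maximum being over all normalized pure states $|\phi^A\rangle$ of the qubits in $A$ and $|\phi^B\rangle$ of the qubits in $B$. Define $\alpha(|\psi\rangle)=\max_{AB}\alpha^{AB}(|\psi\rangle)$ over all such bipartitions, and the multipartite entanglement $E(|\psi\rangle)=1-\alpha(|\psi\rangle)$. The pure biseparable states are the product states $|\phi^A\rangle|\phi^B\rangle$ over all bipartitions. *)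

theory Defs
  imports "HOL-Analysis.Analysis"
begin

text \<open>
  Qubits are labelled by natural numbers. A computational basis state of the qubits in \<open>Q\<close> is
  an extensional function \<open>Q \<rightarrow> {0,1}\<close> (with \<open>True\<close> for \<open>1\<close>), and a state vector is
  given by its amplitudes. Amplitudes outside \<open>basis Q\<close> carry no meaning: norms and
  inner products only look at \<open>basis Q\<close>.
\<close>

type_synonym bits = "nat \<Rightarrow> bool"
type_synonym state = "bits \<Rightarrow> complex"

definition basis :: "nat set \<Rightarrow> bits set" where
  "basis Q = (Q \<rightarrow>\<^sub>E UNIV)"

definition braket :: "nat set \<Rightarrow> state \<Rightarrow> state \<Rightarrow> complex" where
  "braket Q \<phi> \<psi> = (\<Sum>x\<in>basis Q. cnj (\<phi> x) * \<psi> x)"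

definition normalized :: "nat set \<Rightarrow> state \<Rightarrow> bool" where
  "normalized Q \<psi> \<longleftrightarrow> braket Q \<psi> \<psi> = 1"

definition tensor :: "nat set \<Rightarrow> nat set \<Rightarrow> state \<Rightarrow> state \<Rightarrow> state" where
  "tensor A B \<phi>A \<phi>B = (\<lambda>x. \<phi>A (restrict x A) * \<phi>B (restrict x B))"

definition bipartitions :: "nat \<Rightarrow> (nat set \<times> nat set) set" where
  "bipartitions n = {(A, B). A \<noteq> {} \<and> B \<noteq> {} \<and> A \<inter> B = {} \<and> A \<union> B = {1..n}}"

text \<open>
  The maxima over normalized states below are attained maxima, not suprema: \<open>Greatest\<close> is
  unspecified when there is no greatest element.
\<close>

definition alpha_part :: "nat \<Rightarrow> nat set \<Rightarrow> nat set \<Rightarrow> state \<Rightarrow> real" where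
  "alpha_part n A B \<psi> =
     (GREATEST r. \<exists>\<phi>A \<phi>B. normalized A \<phi>A \<and> normalized B \<phi>B \<and>
        r = (cmod (braket {1..n} (tensor A B \<phi>A \<phi>B) \<psi>))\<^sup>2)"

definition alpha :: "nat \<Rightarrow> state \<Rightarrow> real" where
  "alpha n \<psi> = (MAX (A, B)\<in>bipartitions n. alpha_part n A B \<psi>)"

definition entanglement :: "nat \<Rightarrow> state \<Rightarrow> real" where
  "entanglement n \<psi> = 1 - alpha n \<psi>"

definition biseparable :: "nat \<Rightarrow> state \<Rightarrow> bool" where
  "biseparable n \<xi> \<longleftrightarrow>
     (\<exists>A B \<phi>A \<phi>B. (A, B) \<in> bipartitions n \<and> normalized A \<phi>A \<and> normalized B \<phi>B \<and>
        \<xi> = tensor A B \<phi>A \<phi>B)"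

definition ket :: "bool \<Rightarrow> bool \<Rightarrow> complex" where
  "ket a = (\<lambda>b. if b = a then 1 else 0)"

definition plus_qubit :: "bool \<Rightarrow> complex" where
  "plus_qubit = (\<lambda>b. (ket False b + ket True b) / complex_of_real (sqrt 2))"

definition plus_state :: "nat \<Rightarrow> state" where
  "plus_state n = (\<lambda>x. \<Prod>j\<in>{1..n}. plus_qubit (x j))"

definition controlled_Z :: "nat set \<Rightarrow> state \<Rightarrow> state" where
  "controlled_Z e \<psi> = (\<lambda>x. if \<forall>j\<in>e. x j then - \<psi> x else \<psi> x)"

text \<open>The gates commute, so applying them in the order \<open>i = 1, \<dots>, n\<close> is no restriction.\<close>

definition H_state :: "nat \<Rightarrow> state" where
  "H_state n = fold (\<lambda>i. controlled_Z ({1..n} - {i})) [1..<Suc n] (plus_state n)"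

end

theory Submission
  imports Defs
begin

text \<open>
  Up to the factor \<open>1 / sqrt (2\<^sup>n)\<close>, the amplitudes across a bipartition \<open>A | B\<close> with \<open>a = |A| \<le> b = |B|\<close> form a
  sign matrix \<open>M\<close>, so the squared overlap with product states is at most the largest squared
  singular value of \<open>M\<close> divided by \<open>2\<^sup>n\<close>. All entries of \<open>M\<close> are \<open>1\<close> outside the all-ones row and
  column, so for a real vector \<open>u\<close> the form \<open>|M\<^sup>T u|\<^sup>2\<close> depends only on \<open>S\<close> (the sum of all entries),
  \<open>U\<close> (the sum over strings with a single zero) and \<open>u1\<close> (the all-ones entry). Splitting off the
  mean \<open>S / 2\<^sup>a\<close> exhibits \<open>c |u|\<^sup>2 - |M\<^sup>T u|\<^sup>2\<close>, for the claimed \<open>c\<close>, as a sum of squares. The value \<open>c\<close> is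
  attained for \<open>A = {1}\<close> by \<open>u = (1, 1)\<close>, except for \<open>n = 4\<close>, where \<open>A = {1, 2}\<close> and \<open>u = (1, g, g, -1)\<close>
  with \<open>g\<close> the golden ratio.
\<close>

section \<open>Bounds for the quadratic form\<close>

text \<open>\<open>A\<close>, \<open>B\<close> stand for the numbers of basis strings and
  \<open>a\<close>, \<open>b\<close> for the numbers of qubits on the two sides. \<open>m\<close> is
  the mean, \<open>v\<close> and \<open>V\<close> are the deviations of \<open>u1\<close> and
  \<open>U\<close>, and \<open>q\<close> bounds them by the variance term \<open>w\<close>. The
  defect is two nonnegative squares plus \<open>c * w\<close> minus deviation terms, which
  \<open>w\<close> absorbs because \<open>AB\<close> rearranges to
  \<open>2 * b * A \<le> c\<close>.\<close>

lemma even_form_bound: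
  fixes A B a b q S u1 U :: real
  assumes a: "0 < a" and Aa: "2 * a \<le> A" "2 \<le> A" and b: "1 \<le> b"
    and AB: "2 * (a + b) \<le> A * (B - 2 * b)"
    and q: "(u1 - S / A)\<^sup>2 + (U - a * (S / A))\<^sup>2 / a \<le> q - S\<^sup>2 / A"
  shows "B * S\<^sup>2 - 4 * b * S * u1 + 4 * b * u1\<^sup>2 - 4 * S * U + 4 * U\<^sup>2
         \<le> (A * B - 2 * (a + b)) * q"
proof -
  define m v V w where "m = S / A" and "v = u1 - m" and "V = U - a * m" and "w = q - A * m\<^sup>2"
  define c where "c = A * B - 2 * (a + b)"
  have S: "S = A * m" and u1: "u1 = m + v" and U: "U = a * m + V" and qq: "q = A * m\<^sup>2 + w"
    using Aa by (simp_all add: m_def v_def V_def w_def)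
  have w: "v\<^sup>2 + V\<^sup>2 / a \<le> w"
    using q Aa by (simp add: S u1 U qq power2_eq_square field_simps)
  have c1: "2 * b * A \<le> c" and c2: "2 * A \<le> c"
  proof -
    show 1: "2 * b * A \<le> c" using AB by (simp add: c_def algebra_simps)
    have "A * 1 \<le> A * b" using b Aa by (intro mult_left_mono) auto
    with 1 show "2 * A \<le> c" by (simp add: algebra_simps)
  qed
  have "c * v\<^sup>2 + c * (V\<^sup>2 / a) \<le> c * w"
    using mult_left_mono[OF w, of c] c2 Aa by (simp add: algebra_simps)
  moreover have "2 * b * A * v\<^sup>2 \<le> c * v\<^sup>2" by (intro mult_right_mono c1) simp
  moreover have "2 * A * (V\<^sup>2 / a) \<le> c * (V\<^sup>2 / a)" using a by (intro mult_right_mono c2) simp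
  moreover have "0 \<le> 2 * b * (A - 2) * (m + v)\<^sup>2" "0 \<le> 2 * a * (A - 2 * a) * (m + V / a)\<^sup>2"
    using assms by simp_all
  moreover have "c * q - (B * S\<^sup>2 - 4 * b * S * u1 + 4 * b * u1\<^sup>2 - 4 * S * U + 4 * U\<^sup>2)
     = 2 * b * (A - 2) * (m + v)\<^sup>2 + 2 * a * (A - 2 * a) * (m + V / a)\<^sup>2
       + c * w - 2 * b * A * v\<^sup>2 - 2 * A * (V\<^sup>2 / a)"
    using a by (simp add: S u1 U qq c_def power2_eq_square field_simps)
  ultimately show ?thesis by (simp add: c_def)
qed

text \<open>For odd n the corner sign is -1, so \<open>u1\<close> joins \<open>U\<close> in a sum
  over \<open>a + 1\<close> strings. Now \<open>v\<close> enters both deviation terms; each is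
  bounded by the whole of \<open>w\<close>, so \<open>c\<close> has to reach
  \<open>2 * b * A + 2 * A\<close>, which is \<open>AB\<close> rearranged. \<open>Aa\<close> keeps
  the coefficient of the second square nonnegative.\<close>

lemma odd_form_bound:
  fixes A B a b q S u1 U :: real
  assumes a: "0 < a" and Aa: "2 * (a + 1) \<le> A" and b: "1 \<le> b"
    and AB: "2 * (a + b) - 2 \<le> A * (B - 2 * b - 2)"
    and q: "(u1 - S / A)\<^sup>2 + (U - a * (S / A))\<^sup>2 / a \<le> q - S\<^sup>2 / A"
  shows "B * S\<^sup>2 - 4 * b * S * u1 + 4 * b * u1\<^sup>2 - 4 * S * (U + u1) + 4 * (U + u1)\<^sup>2
         \<le> (A * B - 2 * (a + b) + 2) * q"
proof -
  define m v V w where "m = S / A" and "v = u1 - m" and "V = U - a * m" and "w = q - A * m\<^sup>2"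
  define c where "c = A * B - 2 * (a + b) + 2"
  have S: "S = A * m" and u1: "u1 = m + v" and U: "U = a * m + V" and qq: "q = A * m\<^sup>2 + w"
    using Aa a by (simp_all add: m_def v_def V_def w_def)
  have w: "v\<^sup>2 + V\<^sup>2 / a \<le> w"
    using q Aa a by (simp add: S u1 U qq power2_eq_square field_simps)
  \<comment> \<open>Weighted Cauchy-Schwarz with its defect written as a square.\<close>
  have "(v\<^sup>2 + V\<^sup>2 / a) - (v + V)\<^sup>2 / (a + 1) = (a * v - V)\<^sup>2 / (a * (a + 1))"
    using a by (simp add: divide_simps) (simp add: power2_eq_square algebra_simps)
  then have "(v + V)\<^sup>2 / (a + 1) \<le> v\<^sup>2 + V\<^sup>2 / a"
    using a by (smt (verit) divide_nonneg_pos mult_pos_pos zero_le_power2)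
  with w have w2: "(v + V)\<^sup>2 / (a + 1) \<le> w" by simp
  have w1: "v\<^sup>2 \<le> w" using w a by (smt (verit) divide_nonneg_pos zero_le_power2)
  have c: "2 * b * A + 2 * A \<le> c" using AB by (simp add: c_def algebra_simps)
  have "0 \<le> w" using w1 by (smt (verit) zero_le_power2)
  with c have "(2 * b * A + 2 * A) * w \<le> c * w" by (rule mult_right_mono)
  moreover have "2 * b * A * v\<^sup>2 \<le> 2 * b * A * w"
    using w1 Aa a b by (intro mult_left_mono) auto
  moreover have "2 * A * ((v + V)\<^sup>2 / (a + 1)) \<le> 2 * A * w"
    using w2 Aa a by (intro mult_left_mono) auto
  moreover have "0 \<le> 2 * b * (A - 2) * (m + v)\<^sup>2"
    "0 \<le> 2 * (a + 1) * (A - 2 * (a + 1)) * (m + (v + V) / (a + 1))\<^sup>2" "0 \<le> 4 * A * m\<^sup>2"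
    using assms by simp_all
  moreover have "c * q - (B * S\<^sup>2 - 4 * b * S * u1 + 4 * b * u1\<^sup>2 - 4 * S * (U + u1) + 4 * (U + u1)\<^sup>2)
     = 2 * b * (A - 2) * (m + v)\<^sup>2 + 2 * (a + 1) * (A - 2 * (a + 1)) * (m + (v + V) / (a + 1))\<^sup>2
       + 4 * A * m\<^sup>2 + c * w - 2 * b * A * v\<^sup>2 - 2 * A * ((v + V)\<^sup>2 / (a + 1))"
    using a by (simp add: S u1 U qq c_def divide_simps) (simp add: power2_eq_square algebra_simps)
  ultimately show ?thesis by (simp add: c_def algebra_simps)
qed

text \<open>The case \<open>a = 2\<close>, \<open>A = 4\<close> of the odd form, where
  \<open>2 * (a + 1) \<le> A\<close> fails. The square with negative coefficient is merged with the
  surplus \<open>4 * A * m\<^sup>2\<close> into \<open>4 * (m - (v + V))\<^sup>2\<close>, at the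
  price of needing \<open>8 * b + 24 \<le> c\<close>, which is \<open>B\<close>.\<close>

lemma odd_form_bound_2:
  fixes B b q S u1 U :: real
  assumes b: "1 \<le> b" and B: "10 * b + 26 \<le> 4 * B"
    and q: "(u1 - S / 4)\<^sup>2 + (U - 2 * (S / 4))\<^sup>2 / 2 \<le> q - S\<^sup>2 / 4"
  shows "B * S\<^sup>2 - 4 * b * S * u1 + 4 * b * u1\<^sup>2 - 4 * S * (U + u1) + 4 * (U + u1)\<^sup>2
         \<le> (4 * B - 2 * (2 + b) + 2) * q"
proof -
  define m v V w where "m = S / 4" and "v = u1 - m" and "V = U - 2 * m" and "w = q - 4 * m\<^sup>2"
  define c where "c = 4 * B - 2 * (2 + b) + 2"
  have S: "S = 4 * m" and u1: "u1 = m + v" and U: "U = 2 * m + V" and qq: "q = 4 * m\<^sup>2 + w"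
    by (simp_all add: m_def v_def V_def w_def)
  have w: "v\<^sup>2 + V\<^sup>2 / 2 \<le> w"
    using q by (simp add: S u1 U qq power2_eq_square field_simps)
  have "(2 * v - V)\<^sup>2 \<ge> 0" by simp
  then have "(v + V)\<^sup>2 \<le> 3 * (v\<^sup>2 + V\<^sup>2 / 2)"
    by (simp add: power2_eq_square algebra_simps)
  with w have w2: "(v + V)\<^sup>2 \<le> 3 * w" by simp
  have w1: "v\<^sup>2 \<le> w" using w by (smt (verit) divide_nonneg_pos zero_le_power2)
  have c: "8 * b + 24 \<le> c" using B by (simp add: c_def algebra_simps)
  have "0 \<le> w" using w1 by (smt (verit) zero_le_power2)
  with c have "(8 * b + 24) * w \<le> c * w" by (rule mult_right_mono)
  moreover have "8 * b * v\<^sup>2 \<le> 8 * b * w"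
    using w1 b by (intro mult_left_mono) auto
  moreover have "0 \<le> 4 * b * (m + v)\<^sup>2" "0 \<le> 4 * (m - (v + V))\<^sup>2"
    using assms by simp_all
  moreover have "c * q - (B * S\<^sup>2 - 4 * b * S * u1 + 4 * b * u1\<^sup>2 - 4 * S * (U + u1) + 4 * (U + u1)\<^sup>2)
     = 4 * b * (m + v)\<^sup>2 + 4 * (m - (v + V))\<^sup>2 + c * w - 8 * b * v\<^sup>2 - 8 * (v + V)\<^sup>2"
    by (simp add: S u1 U qq c_def) (simp add: power2_eq_square algebra_simps)
  moreover have "(8 * b + 24) * w = 8 * b * w + 24 * w" by (simp add: algebra_simps)
  ultimately show ?thesis using w2 unfolding c_def[symmetric] by linarith
qed

text \<open>For two against three qubits \<open>c = 24\<close> is below \<open>8 * b + 24\<close>,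
  so this case gets its own sum of squares.\<close>

lemma odd_form_bound_2_3:
  fixes q S u1 U :: real
  assumes q: "(u1 - S / 4)\<^sup>2 + (U - 2 * (S / 4))\<^sup>2 / 2 \<le> q - S\<^sup>2 / 4"
  shows "8 * S\<^sup>2 - 12 * S * u1 + 12 * u1\<^sup>2 - 4 * S * (U + u1) + 4 * (U + u1)\<^sup>2 \<le> 24 * q"
proof -
  define m v V w where "m = S / 4" and "v = u1 - m" and "V = U - 2 * m" and "w = q - 4 * m\<^sup>2"
  have S: "S = 4 * m" and u1: "u1 = m + v" and U: "U = 2 * m + V" and qq: "q = 4 * m\<^sup>2 + w"
    by (simp_all add: m_def v_def V_def w_def)
  have w: "v\<^sup>2 + V\<^sup>2 / 2 \<le> w"
    using q by (simp add: S u1 U qq power2_eq_square field_simps)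
  have "24 * q - (8 * S\<^sup>2 - 12 * S * u1 + 12 * u1\<^sup>2 - 4 * S * (U + u1) + 4 * (U + u1)\<^sup>2)
     = 24 * (w - (v\<^sup>2 + V\<^sup>2 / 2)) + 8 * (v + m - V / 2)\<^sup>2 + 8 * m\<^sup>2 + 6 * V\<^sup>2"
    by (simp add: S u1 U qq power2_eq_square field_simps)
  moreover have "\<dots> \<ge> 0" using w by (intro add_nonneg_nonneg) auto
  ultimately show ?thesis by linarith
qed

text \<open>\<open>W\<close> is the entry at the all-zeros string. Equality needs
  \<open>W = - u1\<close> and \<open>U = (1 + sqrt 5) / 2 * (W - u1)\<close>, which is where the
  golden ratio in the optimal vector comes from.\<close>

lemma form_bound_2_2:
  fixes q S u1 U :: real
  assumes q: "u1\<^sup>2 + U\<^sup>2 / 2 + (S - U - u1)\<^sup>2 \<le> q"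
  shows "4 * S\<^sup>2 - 8 * S * u1 + 8 * u1\<^sup>2 - 4 * S * U + 4 * U\<^sup>2 \<le> (6 + 2 * sqrt 5) * q"
proof -
  define W where "W = S - U - u1"
  define r where "r = sqrt 5"
  have S: "S = W + U + u1" by (simp add: W_def)
  have r: "r * r = 5" "1 \<le> r" by (simp_all add: r_def)
  \<comment> \<open>The summand with factor \<open>5 - r * r\<close> is zero; it makes this a
    polynomial identity in \<open>r\<close>.\<close>
  have "(6 + 2 * r) * (u1\<^sup>2 + U\<^sup>2 / 2 + W\<^sup>2)
      - (4 * S\<^sup>2 - 8 * S * u1 + 8 * u1\<^sup>2 - 4 * S * U + 4 * U\<^sup>2)
    = (1 + r) * (W + u1)\<^sup>2 + (r - 1) * (U - (1 + r) / 2 * (W - u1))\<^sup>2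
      + (5 - r * r) * ((1 + r) / 4 * (W - u1)\<^sup>2 - U * (W - u1))"
    unfolding S by (simp add: power2_eq_square field_simps)
  also have "\<dots> \<ge> 0" using r by simp
  finally have "4 * S\<^sup>2 - 8 * S * u1 + 8 * u1\<^sup>2 - 4 * S * U + 4 * U\<^sup>2
      \<le> (6 + 2 * r) * (u1\<^sup>2 + U\<^sup>2 / 2 + W\<^sup>2)" by simp
  also have "\<dots> \<le> (6 + 2 * r) * q"
    using q r unfolding W_def by (intro mult_left_mono) auto
  finally show ?thesis by (simp add: r_def)
qed

section \<open>The sign matrix across a bipartition\<close>

definition ones :: "nat set \<Rightarrow> bits" where
  "ones A = restrict (\<lambda>_. True) A"

definition one_zero :: "nat set \<Rightarrow> bits set" where
  "one_zero A = (\<lambda>j. restrict (\<lambda>i. i \<noteq> j) A) ` A"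

text \<open>The factor for \<open>i\<close> is the sign of the gate on \<open>Q - {i}\<close>. On a
  single qubit that hyperedge is empty and the sign is -1 on both strings, as the splitting over a
  bipartition requires.\<close>

definition hsign :: "nat set \<Rightarrow> bits \<Rightarrow> real" where
  "hsign Q x = (\<Prod>i\<in>Q. if \<forall>j\<in>Q - {i}. x j then - 1 else 1)"

lemma finite_basis [simp]: "finite A \<Longrightarrow> finite (basis A)"
  by (simp add: basis_def finite_PiE)

lemma card_basis: "finite A \<Longrightarrow> card (basis A) = 2 ^ card A"
  by (simp add: basis_def card_funcsetE)

lemma restrict_in_basis [simp]: "restrict x A \<in> basis A"
  by (simp add: basis_def)

lemma ones_in_basis [simp]: "ones A \<in> basis A"
  by (simp add: ones_def)

lemma one_zero_subset_basis: "one_zero A \<subseteq> basis A"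
  by (auto simp: one_zero_def)

lemma ones_notin_one_zero [simp]: "ones A \<notin> one_zero A"
  unfolding one_zero_def ones_def by (auto simp: fun_eq_iff restrict_def split: if_splits)

lemma card_one_zero: "card (one_zero A) = card A"
  unfolding one_zero_def
  by (rule card_image) (auto simp: inj_on_def fun_eq_iff restrict_def split: if_splits)

lemma finite_one_zero [simp]: "finite A \<Longrightarrow> finite (one_zero A)"
  by (simp add: one_zero_def)

lemma eq_ones_iff: "x \<in> basis A \<Longrightarrow> x = ones A \<longleftrightarrow> (\<forall>j\<in>A. x j)"
  by (auto simp: ones_def basis_def fun_eq_iff restrict_def PiE_def extensional_def)

lemma in_one_zero_iff:
  assumes "x \<in> basis A"
  shows "x \<in> one_zero A \<longleftrightarrow> (\<exists>i\<in>A. \<not> x i \<and> (\<forall>j\<in>A - {i}. x j))"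
proof
  assume "\<exists>i\<in>A. \<not> x i \<and> (\<forall>j\<in>A - {i}. x j)"
  then obtain i where "i \<in> A" "\<not> x i" "\<forall>j\<in>A - {i}. x j" by blast
  then have "x = restrict (\<lambda>k. k \<noteq> i) A"
    using assms by (auto simp: basis_def fun_eq_iff restrict_def PiE_def extensional_def)
  with \<open>i \<in> A\<close> show "x \<in> one_zero A" by (simp add: one_zero_def)
qed (auto simp: one_zero_def)

text \<open>All gates fire on the all-ones string. A single zero leaves only the gate that omits it,
  and two zeros leave none.\<close>

lemma hsign_ones: "hsign A (ones A) = (- 1) ^ card A"
  by (simp add: hsign_def ones_def)

lemma hsign_one_zero:
  assumes "finite A" "x \<in> one_zero A"
  shows "hsign A x = - 1"
proof -
  obtain i where i: "i \<in> A" and x: "x = restrict (\<lambda>k. k \<noteq> i) A"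
    using assms(2) by (auto simp: one_zero_def)
  have "hsign A x = (\<Prod>k\<in>A. if k = i then - 1 else 1)"
    unfolding hsign_def x using i by (intro prod.cong) auto
  with assms(1) i show ?thesis by simp
qed

lemma hsign_other:
  assumes "x \<in> basis A" "x \<noteq> ones A" "x \<notin> one_zero A"
  shows "hsign A x = 1"
proof -
  have "\<not> (\<forall>j\<in>A - {i}. x j)" if "i \<in> A" for i
    using assms that by (auto simp: eq_ones_iff in_one_zero_iff)
  then show ?thesis unfolding hsign_def by (intro prod.neutral) auto
qed

text \<open>A hyperedge omitting a qubit of \<open>A\<close> contains all of \<open>B\<close>: its
  gate can fire only if \<open>y\<close> is all ones, and then acts as the corresponding gate on
  \<open>A\<close> alone. The same holds with the sides exchanged.\<close>

lemma hsign_merge: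
  assumes "finite A" "finite B" "A \<inter> B = {}" "x \<in> basis A" "y \<in> basis B"
  shows "hsign (A \<union> B) (merge A B (x, y)) =
    (if y = ones B then hsign A x else 1) * (if x = ones A then hsign B y else 1)"
proof -
  have dj: "\<And>i. i \<in> B \<Longrightarrow> i \<notin> A" using assms(3) by auto
  have 1: "(\<forall>j\<in>A \<union> B - {i}. merge A B (x, y) j) \<longleftrightarrow> (\<forall>j\<in>A - {i}. x j) \<and> (\<forall>j\<in>B. y j)" if "i \<in> A" for i
    using that dj assms(3) by (auto simp: ball_Un Un_Diff)
  have 2: "(\<forall>j\<in>A \<union> B - {i}. merge A B (x, y) j) \<longleftrightarrow> (\<forall>j\<in>A. x j) \<and> (\<forall>j\<in>B - {i}. y j)" if "i \<in> B" for i
    using that dj assms(3) by (auto simp: ball_Un Un_Diff)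
  have "(\<Prod>i\<in>A. if \<forall>j\<in>A \<union> B - {i}. merge A B (x, y) j then - 1 else 1 :: real)
      = (if y = ones B then hsign A x else 1)"
    using assms(5) by (auto simp: 1 eq_ones_iff hsign_def intro!: prod.cong prod.neutral)
  moreover have "(\<Prod>i\<in>B. if \<forall>j\<in>A \<union> B - {i}. merge A B (x, y) j then - 1 else 1 :: real)
      = (if x = ones A then hsign B y else 1)"
    using assms(4) by (auto simp: 2 eq_ones_iff hsign_def intro!: prod.cong prod.neutral)
  ultimately show ?thesis
    unfolding hsign_def[of "A \<union> B"] prod.union_disjoint[OF assms(1-3)] by simp
qed

section \<open>Sums over the three classes of strings\<close>

lemma sum_basis_split:
  fixes f :: "bits \<Rightarrow> 'a::comm_monoid_add"
  assumes "finite A"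
  shows "(\<Sum>x\<in>basis A. f x) =
    f (ones A) + (\<Sum>x\<in>one_zero A. f x) + (\<Sum>x\<in>basis A - insert (ones A) (one_zero A). f x)"
proof -
  have "insert (ones A) (one_zero A) \<subseteq> basis A" using one_zero_subset_basis by auto
  then show ?thesis
    using assms sum.subset_diff[of "insert (ones A) (one_zero A)" "basis A" f]
    by (simp add: add_ac)
qed

lemma real_card_rest:
  assumes "finite A"
  shows "real (card (basis A - insert (ones A) (one_zero A))) = 2 ^ card A - real (card A) - 1"
  using sum_basis_split[OF assms, of "\<lambda>_. 1::real"] assms
  by (simp add: card_basis card_one_zero)

lemma square_sum_div_card_le:
  fixes f :: "'a \<Rightarrow> real"
  shows "(\<Sum>x\<in>F. f x)\<^sup>2 / real (card F) \<le> (\<Sum>x\<in>F. (f x)\<^sup>2)"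
\<comment> \<open>This case covers empty and infinite \<open>F\<close>, where sum and quotient are
  both 0.\<close>
proof (cases "card F = 0")
  case False
  then show ?thesis
    using Cauchy_Schwarz_ineq_sum[of "\<lambda>_. 1" f F] by (simp add: divide_simps mult.commute)
qed (simp add: sum_nonneg)

text \<open>
  The three classes are the all-ones string, the strings with a single zero, and the rest. For
  \<open>card A = 1\<close> the last class is empty and the quotient by its size is \<open>0\<close>.
\<close>

lemma sum_squares_three_classes:
  fixes u :: "bits \<Rightarrow> real" and m S U :: real
  assumes "finite A"
  defines "S \<equiv> \<Sum>x\<in>basis A. u x" and "U \<equiv> \<Sum>x\<in>one_zero A. u x"
  shows "(u (ones A) - m)\<^sup>2 + (U - card A * m)\<^sup>2 / card A
      + (S - U - u (ones A) - (2 ^ card A - real (card A) - 1) * m)\<^sup>2 / (2 ^ card A - real (card A) - 1)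
    \<le> (\<Sum>x\<in>basis A. (u x)\<^sup>2) - 2 * m * S + 2 ^ card A * m\<^sup>2"
proof -
  define R where "R = basis A - insert (ones A) (one_zero A)"
  have cR: "real (card R) = 2 ^ card A - real (card A) - 1"
    unfolding R_def by (rule real_card_rest[OF assms(1)])
  have split: "(\<Sum>x\<in>basis A. f x) = f (ones A) + (\<Sum>x\<in>one_zero A. f x) + (\<Sum>x\<in>R. f x)"
    for f :: "bits \<Rightarrow> real"
    unfolding R_def by (rule sum_basis_split[OF assms(1)])
  have "(\<Sum>x\<in>R. u x) = S - U - u (ones A)"
    using split[of u] by (simp add: S_def U_def)
  then have "(S - U - u (ones A) - (2 ^ card A - real (card A) - 1) * m)\<^sup>2 / (2 ^ card A - real (card A) - 1)
      \<le> (\<Sum>x\<in>R. (u x - m)\<^sup>2)"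
    using square_sum_div_card_le[of "\<lambda>x. u x - m" R] by (simp add: sum_subtractf cR)
  moreover have "(U - card A * m)\<^sup>2 / card A \<le> (\<Sum>x\<in>one_zero A. (u x - m)\<^sup>2)"
    using square_sum_div_card_le[of "\<lambda>x. u x - m" "one_zero A"]
    by (simp add: sum_subtractf card_one_zero U_def)
  moreover have "(\<Sum>x\<in>basis A. (u x - m)\<^sup>2) = (\<Sum>x\<in>basis A. (u x)\<^sup>2) - 2 * m * S + 2 ^ card A * m\<^sup>2"
    by (simp add: power2_diff sum.distrib sum_subtractf S_def sum_distrib_left card_basis[OF assms(1)] mult_ac)
  ultimately show ?thesis
    using split[of "\<lambda>x. (u x - m)\<^sup>2"] by linarith
qed

text \<open>This is |M^T u|^2 for the sign matrix M with rows in \<open>basis A\<close> and columns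
  in \<open>basis B\<close>.\<close>

definition overlap_form :: "nat set \<Rightarrow> nat set \<Rightarrow> (bits \<Rightarrow> real) \<Rightarrow> real" where
  "overlap_form A B u =
     (\<Sum>y\<in>basis B. (\<Sum>x\<in>basis A. u x * hsign (A \<union> B) (merge A B (x, y)))\<^sup>2)"

text \<open>The entry of M^T u depends only on the class of the column: \<open>S\<close> in general,
  \<open>S - 2 * u1\<close> for a single zero, and the last square for all ones, where the row of
  all ones carries the corner sign (-1)^n.\<close>

lemma overlap_form_eq:
  fixes u :: "bits \<Rightarrow> real" and S U u1 :: real
  assumes fin: "finite A" "finite B" and dj: "A \<inter> B = {}"
  defines "S \<equiv> \<Sum>x\<in>basis A. u x" and "U \<equiv> \<Sum>x\<in>one_zero A. u x" and "u1 \<equiv> u (ones A)"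
  shows "overlap_form A B u = (2 ^ card B - 1) * S\<^sup>2 - 4 * real (card B) * S * u1 + 4 * real (card B) * u1\<^sup>2
      + (S - 2 * U - (1 - (- 1) ^ (card A + card B)) * u1)\<^sup>2"
proof -
  define g where "g y = (\<Sum>x\<in>basis A. u x * hsign (A \<union> B) (merge A B (x, y)))" for y
  let ?R = "\<lambda>A. basis A - insert (ones A) (one_zero A)"
  have g: "g y = (\<Sum>x\<in>basis A. u x * ((if y = ones B then hsign A x else 1) * (if x = ones A then hsign B y else 1)))"
    if "y \<in> basis B" for y
    unfolding g_def using hsign_merge[OF fin dj _ that] by (intro sum.cong) auto
  have R: "(\<Sum>x\<in>?R A. u x) = S - U - u1"
    using sum_basis_split[OF fin(1), of u] by (simp add: S_def U_def u1_def)
  have nZ: "(\<Sum>x\<in>one_zero A. u x * (if x = ones A then c else 1)) = U" for c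
    unfolding U_def by (rule sum.cong) auto
  have nR: "(\<Sum>x\<in>?R A. u x * (if x = ones A then c else 1)) = S - U - u1" for c
    unfolding R[symmetric] by (rule sum.cong) auto
  have g_zero: "g y = S - 2 * u1" if "y \<in> one_zero B" for y
  proof -
    have "y \<in> basis B" "y \<noteq> ones B" using that one_zero_subset_basis by auto
    then show ?thesis
      using hsign_one_zero[OF fin(2) that] g[of y]
      by (simp add: sum_basis_split[OF fin(1)] nZ nR R u1_def[symmetric])
  qed
  have g_rest: "g y = S" if "y \<in> ?R B" for y
    using that hsign_other[of y B] g[of y] by (simp add: S_def cong: if_cong)
  have g_ones: "g (ones B) = S - 2 * U - (1 - (- 1) ^ (card A + card B)) * u1"
  proof -
    have "(\<Sum>x\<in>one_zero A. u x * (hsign A x * (if x = ones A then hsign B (ones B) else 1))) = - U"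
      unfolding U_def sum_negf[symmetric] using fin by (intro sum.cong) (auto simp: hsign_one_zero)
    moreover have "(\<Sum>x\<in>?R A. u x * (hsign A x * (if x = ones A then hsign B (ones B) else 1))) = S - U - u1"
      unfolding R[symmetric] by (intro sum.cong) (auto simp: hsign_other)
    ultimately show ?thesis
      by (simp add: g sum_basis_split[OF fin(1)] hsign_ones u1_def[symmetric] power_add algebra_simps)
  qed
  have "overlap_form A B u = (\<Sum>y\<in>basis B. (g y)\<^sup>2)"
    by (simp add: overlap_form_def g_def)
  also have "\<dots> = (g (ones B))\<^sup>2 + card B * (S - 2 * u1)\<^sup>2 + (2 ^ card B - real (card B) - 1) * S\<^sup>2"
  proof -
    have "(\<Sum>y\<in>?R B. (g y)\<^sup>2) = (\<Sum>y\<in>?R B. S\<^sup>2)" by (intro sum.cong refl) (simp only: g_rest)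
    also have "\<dots> = (2 ^ card B - real (card B) - 1) * S\<^sup>2"
      by (simp only: sum_constant real_card_rest[OF fin(2)])
    finally show ?thesis
      by (simp add: sum_basis_split[OF fin(2)] g_zero card_one_zero)
  qed
  finally show ?thesis
    unfolding g_ones by (simp add: power2_eq_square algebra_simps)
qed

text \<open>The claimed \<alpha> multiplied by \<open>2 ^ n\<close>.\<close>

definition overlap_cap :: "nat \<Rightarrow> real" where
  "overlap_cap n = (if n = 4 then 6 + 2 * sqrt 5
     else if even n then 2 ^ n - 2 * real n else 2 ^ n - 2 * real n + 2)"

section \<open>Growth of powers of two and the bound on the form\<close>

lemma two_power_ge_linear: "4 \<le> b \<Longrightarrow> 4 * real b \<le> 2 ^ b"
  by (induction b rule: dec_induct) auto

lemma two_power_ge_twice: "1 \<le> a \<Longrightarrow> 2 * real a \<le> 2 ^ a"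
  by (induction a rule: dec_induct) (auto simp: self_le_power)

lemma two_power_ge_twice_Suc: "3 \<le> a \<Longrightarrow> 2 * (real a + 1) \<le> 2 ^ a"
  by (induction a rule: dec_induct) auto

text \<open>The form bounds above are applied according to the parity of n and the size of
  \<open>A\<close>; the few small pairs of sizes where the general inequalities fail are treated by
  hand.\<close>

lemma overlap_form_le:
  fixes u :: "bits \<Rightarrow> real"
  assumes fin: "finite A" "finite B" and dj: "A \<inter> B = {}"
    and a: "1 \<le> card A" and ab: "card A \<le> card B" and n: "3 \<le> card A + card B"
  shows "overlap_form A B u \<le> overlap_cap (card A + card B) * (\<Sum>x\<in>basis A. (u x)\<^sup>2)"
proof -
  define a b S U u1 q where "a = card A" and "b = card B"
    and "S = (\<Sum>x\<in>basis A. u x)" and "U = (\<Sum>x\<in>one_zero A. u x)" and "u1 = u (ones A)"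
    and "q = (\<Sum>x\<in>basis A. (u x)\<^sup>2)"
  note defs = a_def b_def S_def U_def u1_def q_def
  have form: "overlap_form A B u = (2 ^ b - 1) * S\<^sup>2 - 4 * real b * S * u1 + 4 * real b * u1\<^sup>2
      + (S - 2 * U - (1 - (- 1) ^ (a + b)) * u1)\<^sup>2"
    unfolding defs by (rule overlap_form_eq[OF fin dj])
  have classes: "(u1 - m)\<^sup>2 + (U - a * m)\<^sup>2 / a + (S - U - u1 - (2 ^ a - real a - 1) * m)\<^sup>2 / (2 ^ a - real a - 1)
      \<le> q - 2 * m * S + 2 ^ a * m\<^sup>2" for m :: real
    unfolding defs by (rule sum_squares_three_classes[OF fin(1)])
  have a1: "1 \<le> a" and ab: "a \<le> b" and n3: "3 \<le> a + b" using assms by (simp_all add: defs)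
  have pa: "real a + 1 \<le> 2 ^ a" by (induction a) auto
  \<comment> \<open>\<open>m\<close> is taken to be the mean, and the nonnegative term of the third
    class is dropped.\<close>
  have q: "(u1 - S / 2 ^ a)\<^sup>2 + (U - a * (S / 2 ^ a))\<^sup>2 / a \<le> q - S\<^sup>2 / 2 ^ a"
  proof -
    have "q - 2 * (S / 2 ^ a) * S + 2 ^ a * (S / 2 ^ a)\<^sup>2 = q - S\<^sup>2 / 2 ^ a"
      by (simp add: power2_eq_square)
    moreover have "0 \<le> (S - U - u1 - (2 ^ a - real a - 1) * (S / 2 ^ a))\<^sup>2 / (2 ^ a - real a - 1)"
      using pa by simp
    ultimately show ?thesis using classes[of "S / 2 ^ a"] by linarith
  qed
  \<comment> \<open>One qubit has only two strings, so the third class is empty and \<open>U\<close>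
    is a single entry.\<close>
  have single: "u1\<^sup>2 + U\<^sup>2 \<le> q" "S = u1 + U" if "a = 1"
  proof -
    have "card (basis A - insert (ones A) (one_zero A)) = 0"
      using real_card_rest[OF fin(1)] that by (simp add: a_def)
    then have "basis A - insert (ones A) (one_zero A) = {}"
      using fin(1) by (subst (asm) card_0_eq) auto
    then show "S = u1 + U"
      unfolding S_def U_def u1_def sum_basis_split[OF fin(1), of u] by (simp only: sum.empty add_0_right)
    show "u1\<^sup>2 + U\<^sup>2 \<le> q" using classes[of 0] that by simp
  qed
  have even_form: "overlap_form A B u = 2 ^ b * S\<^sup>2 - 4 * real b * S * u1 + 4 * real b * u1\<^sup>2 - 4 * S * U + 4 * U\<^sup>2"
    if "even (a + b)"
    unfolding form using that by (simp add: power2_eq_square algebra_simps)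
  have odd_form: "overlap_form A B u
      = 2 ^ b * S\<^sup>2 - 4 * real b * S * u1 + 4 * real b * u1\<^sup>2 - 4 * S * (U + u1) + 4 * (U + u1)\<^sup>2"
    if "odd (a + b)"
    unfolding form using that by (simp add: power2_eq_square algebra_simps)
  \<comment> \<open>For odd n parity forces b = 3 or b at least 5 when a = 2, and b at least 4 when
    a is at least 3.\<close>
  consider "a + b = 4" | "even (a + b)" "6 \<le> a + b" | "odd (a + b)" "a = 1"
    | "odd (a + b)" "a = 2" "b = 3" | "odd (a + b)" "a = 2" "5 \<le> b" | "odd (a + b)" "3 \<le> a" "4 \<le> b"
  proof -
    have "odd (a + b) \<Longrightarrow> a = 2 \<Longrightarrow> b = 3 \<or> 5 \<le> b" "odd (a + b) \<Longrightarrow> 3 \<le> a \<Longrightarrow> 4 \<le> b"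
      "even (a + b) \<Longrightarrow> a + b = 4 \<or> 6 \<le> a + b" using ab n3 by presburger+
    moreover have "a = 1 \<or> a = 2 \<or> 3 \<le> a" using a1 by auto
    ultimately show ?thesis using that by blast
  qed
  then have "overlap_form A B u \<le> overlap_cap (a + b) * q"
  proof cases
    case 1
    then have "a = 1 \<and> b = 3 \<or> a = 2 \<and> b = 2" using a1 ab by auto
    then show ?thesis
    proof
      assume A: "a = 1 \<and> b = 3"
      \<comment> \<open>The two rows of the sign matrix are orthogonal here; 8 is below the cap
        because \<open>1 \<le> sqrt 5\<close>.\<close>
      have "overlap_form A B u = 8 * (u1\<^sup>2 + U\<^sup>2)"
        using 1 A single(2) by (simp add: even_form power2_eq_square algebra_simps)
      also have "\<dots> \<le> 8 * q" using single A by simp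
      also have "\<dots> \<le> (6 + 2 * sqrt 5) * q"
        by (intro mult_right_mono) (auto simp: q_def sum_nonneg)
      finally show ?thesis using 1 by (simp add: overlap_cap_def)
    next
      assume A: "a = 2 \<and> b = 2"
      \<comment> \<open>At \<open>m = 0\<close> the class inequality bounds the squares themselves;
        the third class is one string.\<close>
      then show ?thesis
        using form_bound_2_2[of u1 U S q] classes[of 0] by (simp add: even_form overlap_cap_def)
    qed
  next
    case 2
    have "2 * (real a + real b) \<le> 2 ^ a * (2 ^ b - 2 * real b)"
    \<comment> \<open>The bound \<open>4 * real b \<le> 2 ^ b\<close> fails only here, and then
      \<open>a = 3\<close>.\<close>
    proof (cases "b = 3")
      case True
      then show ?thesis using 2 ab by (cases "a = 3") auto
    next
      case False
      then have b: "4 * real b \<le> 2 ^ b" using 2 ab by (intro two_power_ge_linear) auto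
      have "2 * (real a + real b) \<le> 2 * (2 * real b)" using ab by simp
      also have "\<dots> \<le> 2 ^ a * (2 ^ b - 2 * real b)"
        using b pa a1 by (intro mult_mono) auto
      finally show ?thesis .
    qed
    moreover have "2 * real a \<le> 2 ^ a"
      using a1 by (rule two_power_ge_twice)
    ultimately have "overlap_form A B u \<le> (2 ^ a * 2 ^ b - 2 * (real a + real b)) * q"
      unfolding even_form[OF 2(1)] using a1 ab pa q by (intro even_form_bound) auto
    then show ?thesis using 2 by (simp add: overlap_cap_def power_add)
  next
    case 3
    have B: "2 * real b \<le> 2 ^ b"
      using a1 ab by (intro two_power_ge_twice) simp
    \<comment> \<open>For a = 1 the condition \<open>2 * (a + 1) \<le> A\<close> fails, but the form
      has just two variables and is diagonal in \<open>u1 + U\<close> and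
      \<open>u1 - U\<close>.\<close>
    have "overlap_form A B u = (2 * 2 ^ b - 2 * real b) * (u1\<^sup>2 + U\<^sup>2) - (2 ^ b - 2 * real b) * (u1 - U)\<^sup>2"
      using 3 single(2) by (simp add: odd_form power2_eq_square algebra_simps)
    also have "\<dots> \<le> (2 * 2 ^ b - 2 * real b) * (u1\<^sup>2 + U\<^sup>2)" using B by simp
    also have "\<dots> \<le> (2 * 2 ^ b - 2 * real b) * q"
      using B single 3 by (intro mult_left_mono) auto
    finally show ?thesis using 3 by (auto simp: overlap_cap_def)
  next
    case 4
    then show ?thesis using odd_form_bound_2_3[of u1 S U q] q by (simp add: odd_form overlap_cap_def)
  next
    case 5
    have "10 * real b + 26 \<le> 4 * 2 ^ b" using 5(3) by (induction b rule: dec_induct) auto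
    then have "overlap_form A B u \<le> (4 * 2 ^ b - 2 * (2 + real b) + 2) * q"
      unfolding odd_form[OF 5(1)] using q 5 by (intro odd_form_bound_2) auto
    then show ?thesis using 5 by (auto simp: overlap_cap_def power_add)
  next
    case 6
    have A8: "8 \<le> (2::real) ^ a" using power_increasing[OF 6(2), of "2::real"] by simp
    have b: "4 * real b \<le> 2 ^ b" using 6 by (intro two_power_ge_linear)
    have "2 * (real a + real b) - 2 \<le> 8 * (2 * real b - 2)" using ab 6 by simp
    also have "\<dots> \<le> 2 ^ a * (2 ^ b - 2 * real b - 2)"
      using A8 b 6 by (intro mult_mono) auto
    finally have "overlap_form A B u \<le> (2 ^ a * 2 ^ b - 2 * (real a + real b) + 2) * q"
      unfolding odd_form[OF 6(1)] using a1 ab q two_power_ge_twice_Suc[OF 6(2)]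
      by (intro odd_form_bound) auto
    then show ?thesis using 6 by (auto simp: overlap_cap_def power_add)
  qed
  then show ?thesis by (simp add: defs)
qed

section \<open>Overlaps with product states\<close>

lemma fold_controlled_Z:
  "fold (\<lambda>i. controlled_Z (e i)) is \<psi> x
     = (\<Prod>i\<leftarrow>is. if \<forall>j\<in>e i. x j then - 1 else 1) * \<psi> x"
  by (induction "is" arbitrary: \<psi>) (auto simp: controlled_Z_def)

lemma H_state_eq: "H_state n x = complex_of_real (hsign {1..n} x / sqrt 2 ^ n)"
proof -
  have "plus_state n x = 1 / complex_of_real (sqrt 2) ^ n"
  proof -
    have "plus_qubit b = 1 / complex_of_real (sqrt 2)" for b
      by (simp add: plus_qubit_def ket_def)
    then show ?thesis by (simp add: plus_state_def power_divide)
  qed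
  moreover have "(\<Prod>i\<leftarrow>[1..<Suc n]. if \<forall>j\<in>{1..n} - {i}. x j then - 1 else 1)
      = complex_of_real (hsign {1..n} x)"
  proof -
    have "set [1..<Suc n] = {1..n}" by auto
    then show ?thesis
      unfolding hsign_def of_real_prod
      by (subst prod.distinct_set_conv_list[symmetric]) (auto intro!: prod.cong)
  qed
  ultimately show ?thesis by (simp add: H_state_def fold_controlled_Z)
qed

section \<open>Norms, contractions and Cauchy-Schwarz\<close>

lemma normalized_iff: "normalized Q \<phi> \<longleftrightarrow> (\<Sum>x\<in>basis Q. (cmod (\<phi> x))\<^sup>2) = 1"
proof -
  have "braket Q \<phi> \<phi> = complex_of_real (\<Sum>x\<in>basis Q. (cmod (\<phi> x))\<^sup>2)"
    unfolding braket_def of_real_sum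
    by (intro sum.cong refl) (simp only: complex_norm_square mult.commute)
  then show ?thesis by (simp only: normalized_def of_real_eq_1_iff)
qed

text \<open>The unnormalized state left on \<open>B\<close> after projecting the \<open>A\<close>
  side onto \<open>\<phi>\<close>.\<close>

definition contract :: "nat set \<Rightarrow> nat set \<Rightarrow> state \<Rightarrow> state \<Rightarrow> state" where
  "contract A B \<phi> \<psi> = (\<lambda>y. \<Sum>x\<in>basis A. cnj (\<phi> x) * \<psi> (merge A B (x, y)))"

text \<open>With the \<open>A\<close> factor fixed, optimizing the \<open>B\<close> factor becomes a
  Cauchy-Schwarz problem on \<open>B\<close> alone.\<close>

lemma braket_tensor:
  assumes "A \<inter> B = {}"
  shows "braket (A \<union> B) (tensor A B \<phi>A \<phi>B) \<psi> = braket B \<phi>B (contract A B \<phi>A \<psi>)"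
proof -
  have "braket (A \<union> B) (tensor A B \<phi>A \<phi>B) \<psi>
      = (\<Sum>(x, y)\<in>basis A \<times> basis B. cnj (\<phi>B y) * (cnj (\<phi>A x) * \<psi> (merge A B (x, y))))"
    unfolding braket_def tensor_def
  proof (rule sum.reindex_bij_witness[where i="merge A B" and j="\<lambda>z. (restrict z A, restrict z B)"])
    fix z assume "z \<in> basis (A \<union> B)"
    then have "merge A B (restrict z A, restrict z B) = z"
      by (auto simp: merge_def basis_def fun_eq_iff PiE_def extensional_def)
    then show "merge A B (restrict z A, restrict z B) = z"
      "(case (restrict z A, restrict z B) of (x, y) \<Rightarrow> cnj (\<phi>B y) * (cnj (\<phi>A x) * \<psi> (merge A B (x, y))))
       = cnj (\<phi>A (restrict z A) * \<phi>B (restrict z B)) * \<psi> z"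
      by simp_all
  qed (use assms in \<open>auto simp: basis_def PiE_def extensional_restrict\<close>)
  also have "\<dots> = braket B \<phi>B (contract A B \<phi>A \<psi>)"
    unfolding braket_def contract_def sum_distrib_left
    by (subst sum.swap) (simp add: sum.cartesian_product)
  finally show ?thesis .
qed

lemma cmod_braket_le:
  assumes "normalized Q \<phi>"
  shows "(cmod (braket Q \<phi> \<psi>))\<^sup>2 \<le> (\<Sum>x\<in>basis Q. (cmod (\<psi> x))\<^sup>2)"
proof -
  have "cmod (braket Q \<phi> \<psi>) \<le> (\<Sum>x\<in>basis Q. cmod (\<phi> x) * cmod (\<psi> x))"
    unfolding braket_def by (rule order_trans[OF norm_sum]) (simp add: norm_mult)
  then have "(cmod (braket Q \<phi> \<psi>))\<^sup>2 \<le> (\<Sum>x\<in>basis Q. cmod (\<phi> x) * cmod (\<psi> x))\<^sup>2"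
    by (rule power_mono) simp
  also have "\<dots> \<le> (\<Sum>x\<in>basis Q. (cmod (\<phi> x))\<^sup>2) * (\<Sum>x\<in>basis Q. (cmod (\<psi> x))\<^sup>2)"
    by (rule Cauchy_Schwarz_ineq_sum)
  finally show ?thesis using assms by (simp add: normalized_iff)
qed

lemma cmod_braket_attained:
  assumes "0 < (\<Sum>x\<in>basis Q. (cmod (\<psi> x))\<^sup>2)"
  shows "\<exists>\<phi>. normalized Q \<phi> \<and> (cmod (braket Q \<phi> \<psi>))\<^sup>2 = (\<Sum>x\<in>basis Q. (cmod (\<psi> x))\<^sup>2)"
proof -
  define N where "N = (\<Sum>x\<in>basis Q. (cmod (\<psi> x))\<^sup>2)"
  \<comment> \<open>Equality in Cauchy-Schwarz: \<open>\<psi>\<close> itself, normalized.\<close>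
  define \<phi> where "\<phi> = (\<lambda>x. \<psi> x / complex_of_real (sqrt N))"
  have N: "0 < N" using assms by (simp add: N_def)
  have "normalized Q \<phi>"
    using N by (simp add: normalized_iff \<phi>_def norm_divide power_divide sum_divide_distrib[symmetric] N_def)
  moreover have "braket Q \<phi> \<psi> = complex_of_real (N / sqrt N)"
    unfolding braket_def \<phi>_def N_def of_real_divide of_real_sum sum_divide_distrib
    by (intro sum.cong refl) (simp add: complex_norm_square mult.commute del: of_real_power)
  ultimately show ?thesis
    using N by (intro exI[of _ \<phi>]) (simp add: norm_divide power_divide flip: N_def, simp add: power2_eq_square)
qed

text \<open>The amplitudes of the hypergraph state are real, so the real and imaginary parts of
  \<open>\<phi>\<close> decouple and bounds for real vectors suffice.\<close>

lemma sum_contract_H_state: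
  assumes n: "A \<union> B = {1..n}"
  shows "(\<Sum>y\<in>basis B. (cmod (contract A B \<phi> (H_state n) y))\<^sup>2)
    = (overlap_form A B (\<lambda>x. Re (\<phi> x)) + overlap_form A B (\<lambda>x. Im (\<phi> x))) / 2 ^ n"
proof -
  have s: "(sqrt 2 ^ n)\<^sup>2 = 2 ^ n" by (simp add: power2_eq_square power_mult_distrib[symmetric])
  have "(cmod (contract A B \<phi> (H_state n) y))\<^sup>2
      = ((\<Sum>x\<in>basis A. Re (\<phi> x) * hsign (A \<union> B) (merge A B (x, y)))\<^sup>2
        + (\<Sum>x\<in>basis A. Im (\<phi> x) * hsign (A \<union> B) (merge A B (x, y)))\<^sup>2) / 2 ^ n" for y
  proof -
    \<comment> \<open>The minus sign of the imaginary part comes from \<open>cnj\<close> and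
      disappears on squaring.\<close>
    have "Re (contract A B \<phi> (H_state n) y)
        = (\<Sum>x\<in>basis A. Re (\<phi> x) * hsign (A \<union> B) (merge A B (x, y))) / sqrt 2 ^ n"
      "Im (contract A B \<phi> (H_state n) y)
        = - (\<Sum>x\<in>basis A. Im (\<phi> x) * hsign (A \<union> B) (merge A B (x, y))) / sqrt 2 ^ n"
      by (simp_all add: contract_def H_state_eq n sum_divide_distrib sum_negf del: of_real_divide of_real_power)
    then show ?thesis
      by (simp add: cmod_power2 power_divide s add_divide_distrib)
  qed
  then show ?thesis
    by (simp add: overlap_form_def sum.distrib sum_divide_distrib[symmetric])
qed

lemma overlap_sq_le_cap:
  assumes "(A, B) \<in> bipartitions n" "3 \<le> n" "normalized A \<phi>A" "normalized B \<phi>B"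
  shows "(cmod (braket {1..n} (tensor A B \<phi>A \<phi>B) (H_state n)))\<^sup>2 \<le> overlap_cap n / 2 ^ n"
proof -
  have le: "(cmod (braket {1..n} (tensor A B \<phi>A \<phi>B) (H_state n)))\<^sup>2 \<le> overlap_cap n / 2 ^ n"
    if "card A \<le> card B" "(A, B) \<in> bipartitions n" "normalized A \<phi>A" "normalized B \<phi>B" for A B \<phi>A \<phi>B
  proof -
    have bip: "A \<noteq> {}" "A \<inter> B = {}" "A \<union> B = {1..n}" using that by (auto simp: bipartitions_def)
    then have fin: "finite A" "finite B" by (metis finite_Un finite_atLeastAtMost)+
    have n: "card A + card B = n" using bip fin card_Un_disjoint[of A B] by simp
    have "1 \<le> card A" using bip fin by (simp add: Suc_leI card_gt_0_iff)
    then have bound: "overlap_form A B u \<le> overlap_cap n * (\<Sum>x\<in>basis A. (u x)\<^sup>2)" for u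
      using overlap_form_le[OF fin bip(2)] n that(1) assms(2) by simp
    have "(cmod (braket {1..n} (tensor A B \<phi>A \<phi>B) (H_state n)))\<^sup>2
        \<le> (\<Sum>y\<in>basis B. (cmod (contract A B \<phi>A (H_state n) y))\<^sup>2)"
      using braket_tensor[OF bip(2), of \<phi>A \<phi>B] bip(3) cmod_braket_le that(4) by simp
    also have "\<dots> \<le> (overlap_cap n * (\<Sum>x\<in>basis A. (Re (\<phi>A x))\<^sup>2)
        + overlap_cap n * (\<Sum>x\<in>basis A. (Im (\<phi>A x))\<^sup>2)) / 2 ^ n"
      unfolding sum_contract_H_state[OF bip(3)] by (intro divide_right_mono add_mono bound) simp
    also have "\<dots> = overlap_cap n * (\<Sum>x\<in>basis A. (cmod (\<phi>A x))\<^sup>2) / 2 ^ n"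
      by (simp add: cmod_power2 sum.distrib distrib_left)
    finally show ?thesis using that(3) by (simp add: normalized_iff)
  qed
  \<comment> \<open>Exchanging the factors reduces the remaining case to a smaller first
    side.\<close>
  have "tensor A B \<phi>A \<phi>B = tensor B A \<phi>B \<phi>A" by (simp add: tensor_def mult.commute)
  moreover have "(B, A) \<in> bipartitions n" using assms(1) by (auto simp: bipartitions_def)
  ultimately show ?thesis using assms le by (metis linear)
qed

text \<open>A real vector that is extremal for the form, once normalized, serves as the
  \<open>A\<close> factor; the normalized contraction is the \<open>B\<close> factor.\<close>

lemma overlap_sq_attains_cap:
  assumes bip: "(A, B) \<in> bipartitions n" and cap: "0 < overlap_cap n"
    and q: "0 < (\<Sum>x\<in>basis A. (u x)\<^sup>2)"
    and u: "overlap_form A B u = overlap_cap n * (\<Sum>x\<in>basis A. (u x)\<^sup>2)"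
  shows "\<exists>\<phi>A \<phi>B. normalized A \<phi>A \<and> normalized B \<phi>B \<and>
    overlap_cap n / 2 ^ n = (cmod (braket {1..n} (tensor A B \<phi>A \<phi>B) (H_state n)))\<^sup>2"
proof -
  have AB: "A \<inter> B = {}" "A \<union> B = {1..n}" using bip by (auto simp: bipartitions_def)
  define q where "q = (\<Sum>x\<in>basis A. (u x)\<^sup>2)"
  define \<phi> where "\<phi> = (\<lambda>x. complex_of_real (u x / sqrt q))"
  have q0: "0 < q" using q by (simp add: q_def)
  have norm: "normalized A \<phi>"
    using q0 by (simp add: normalized_iff \<phi>_def norm_divide power_divide sum_divide_distrib[symmetric] q_def)
  have "overlap_form A B (\<lambda>x. u x / sqrt q) = overlap_form A B u / q"
    using q0 by (simp add: overlap_form_def sum_divide_distrib[symmetric] power_divide)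
  moreover have "overlap_form A B (\<lambda>x. 0) = 0" by (simp add: overlap_form_def)
  ultimately have "(\<Sum>y\<in>basis B. (cmod (contract A B \<phi> (H_state n) y))\<^sup>2) = overlap_cap n / 2 ^ n"
    unfolding sum_contract_H_state[OF AB(2)] using q0 u by (simp add: \<phi>_def q_def)
  then show ?thesis
    using cmod_braket_attained[where Q = B and \<psi> = "contract A B \<phi> (H_state n)"] cap norm
      braket_tensor[OF AB(1), of \<phi> _ "H_state n"] AB(2) by (smt (verit) divide_pos_pos zero_less_power)
qed

lemma overlap_cap_attained:
  assumes "3 \<le> n"
  shows "\<exists>A B \<phi>A \<phi>B. (A, B) \<in> bipartitions n \<and> normalized A \<phi>A \<and> normalized B \<phi>B \<and>
    overlap_cap n / 2 ^ n = (cmod (braket {1..n} (tensor A B \<phi>A \<phi>B) (H_state n)))\<^sup>2"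
proof (cases "n = 4")
  case True
  define A B :: "nat set" where "A = {1, 2}" and "B = {3, 4}"
  define g :: real where "g = (1 + sqrt 5) / 2"
  \<comment> \<open>The equality case of \<open>form_bound_2_2\<close>: \<open>W = 1\<close>,
    \<open>u1 = -1\<close>, and \<open>U = 2 * g\<close> shared by two strings.\<close>
  define u :: "bits \<Rightarrow> real" where "u x = (if x = ones A then - 1 else if x \<in> one_zero A then g else 1)" for x
  have g: "g * g = g + 1" by (simp add: g_def field_simps)
  have bip: "(A, B) \<in> bipartitions n" using True by (auto simp: bipartitions_def A_def B_def)
  have fin: "finite A" "finite B" and dj: "A \<inter> B = {}" and card: "card A = 2" "card B = 2"
    by (auto simp: A_def B_def)
  have Z: "(\<Sum>x\<in>one_zero A. f (u x)) = 2 * f g" for f :: "real \<Rightarrow> real"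
  proof -
    have "(\<Sum>x\<in>one_zero A. f (u x)) = (\<Sum>x\<in>one_zero A. f g)" by (intro sum.cong refl) (auto simp: u_def)
    then show ?thesis by (simp add: card_one_zero card)
  qed
  have R: "(\<Sum>x\<in>basis A - insert (ones A) (one_zero A). f (u x)) = f 1" for f :: "real \<Rightarrow> real"
  proof -
    have "(\<Sum>x\<in>basis A - insert (ones A) (one_zero A). f (u x))
        = (\<Sum>x\<in>basis A - insert (ones A) (one_zero A). f 1)" by (intro sum.cong refl) (auto simp: u_def)
    then show ?thesis unfolding sum_constant real_card_rest[OF fin(1)] card by simp
  qed
  have split: "(\<Sum>x\<in>basis A. f (u x)) = f (- 1) + 2 * f g + f 1" for f :: "real \<Rightarrow> real"
    unfolding sum_basis_split[OF fin(1)] Z R by (simp add: u_def)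
  have q: "(\<Sum>x\<in>basis A. (u x)\<^sup>2) = 2 + 2 * (g * g)"
    using split[of "\<lambda>t. t\<^sup>2"] by (simp add: power2_eq_square)
  have "overlap_form A B u = overlap_cap n * (\<Sum>x\<in>basis A. (u x)\<^sup>2)"
    unfolding overlap_form_eq[OF fin dj] q
    using split[of "\<lambda>t. t"] Z[of "\<lambda>t. t"]
    by (simp add: card True overlap_cap_def u_def) (simp add: g_def power2_eq_square field_simps)
  moreover have "0 < overlap_cap n" using True by (simp add: overlap_cap_def add_pos_nonneg)
  moreover have "0 < (\<Sum>x\<in>basis A. (u x)\<^sup>2)" unfolding q by (simp add: add_pos_nonneg)
  ultimately show ?thesis using overlap_sq_attains_cap[OF bip, of u] bip by blast
next
  case False
  define A B where "A = {1::nat}" and "B = {2..n}"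
  have bip: "(A, B) \<in> bipartitions n" using assms by (auto simp: bipartitions_def A_def B_def)
  have fin: "finite A" "finite B" and dj: "A \<inter> B = {}" and card: "card A = 1" "card B = n - 1"
    by (auto simp: A_def B_def)
  have 1: "(\<Sum>x\<in>basis A. 1::real) = 2" "(\<Sum>x\<in>one_zero A. 1::real) = 1"
    using fin by (simp_all add: card_basis card_one_zero card)
  obtain k where k: "n = Suc k" using assms by (cases n) auto
  \<comment> \<open>Each column sums to 2, except that single-zero columns sum to 0 and the all-ones
    column sums to 0 for even n and to -2 for odd n.\<close>
  have "overlap_form A B (\<lambda>_. 1) = overlap_cap n * (\<Sum>x\<in>basis A. 1\<^sup>2)"
    unfolding overlap_form_eq[OF fin dj] using False
    by (auto simp: 1[simplified] card k overlap_cap_def power2_eq_square algebra_simps)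
  moreover have "0 < overlap_cap n"
  proof (cases "n = 3")
    case False
    then have "4 * real n \<le> 2 ^ n" using \<open>n \<noteq> 4\<close> assms by (intro two_power_ge_linear) auto
    then show ?thesis using assms by (auto simp: overlap_cap_def add_pos_nonneg)
  qed (simp add: overlap_cap_def)
  ultimately show ?thesis using overlap_sq_attains_cap[OF bip, of "\<lambda>_. 1"] bip 1 by fastforce
qed

section \<open>Existence of the maxima\<close>

text \<open>Amplitudes off the basis are unconstrained by the norm; fixing them at 0 puts the states
  into a product of unit discs and points, compact by Tychonoff, cut by a closed sphere
  condition.\<close>

lemma compact_normalized_states:
  assumes "finite Q"
  shows "compact {\<phi>. normalized Q \<phi> \<and> (\<forall>x. x \<notin> basis Q \<longrightarrow> \<phi> x = 0)}"
proof -
  let ?P = "PiE UNIV (\<lambda>x. if x \<in> basis Q then cball 0 1 else {0}) :: state set"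
  have "compact ?P"
    unfolding compactin_euclidean_iff[symmetric] euclidean_product_topology[symmetric] compactin_PiE
    by simp
  moreover have "closed {\<phi>. (\<Sum>x\<in>basis Q. (cmod (\<phi> x))\<^sup>2) = 1}"
    by (intro closed_Collect_eq continuous_intros continuous_on_product_coordinates)
  ultimately have "compact (?P \<inter> {\<phi>. (\<Sum>x\<in>basis Q. (cmod (\<phi> x))\<^sup>2) = 1})"
    by (rule compact_Int_closed)
  moreover have "{\<phi>. normalized Q \<phi> \<and> (\<forall>x. x \<notin> basis Q \<longrightarrow> \<phi> x = 0)}
      = ?P \<inter> {\<phi>. (\<Sum>x\<in>basis Q. (cmod (\<phi> x))\<^sup>2) = 1}"
  proof -
    have "cmod (\<phi> x) \<le> 1" if "(\<Sum>x\<in>basis Q. (cmod (\<phi> x))\<^sup>2) = 1" "x \<in> basis Q" for \<phi> x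
      using member_le_sum[of x "basis Q" "\<lambda>x. (cmod (\<phi> x))\<^sup>2"] that assms
      by (simp add: power2_le_iff_abs_le[of 1, simplified])
    then show ?thesis by (auto simp: normalized_iff PiE_iff split: if_splits)
  qed
  ultimately show ?thesis by simp
qed

lemma ex_normalized: "finite Q \<Longrightarrow> \<exists>\<phi>. normalized Q \<phi> \<and> (\<forall>x. x \<notin> basis Q \<longrightarrow> \<phi> x = 0)"
proof (intro exI conjI)
  assume "finite Q"
  moreover have "(\<Sum>x\<in>basis Q. (cmod (if x = ones Q then 1 else 0))\<^sup>2) = (\<Sum>x\<in>basis Q. if x = ones Q then 1 else 0)"
    by (intro sum.cong) auto
  ultimately show "normalized Q (\<lambda>x. if x = ones Q then 1 else 0)"
    by (simp add: normalized_iff)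
qed auto

text \<open>A continuous function on a product of two compact sets of states attains its
  maximum.\<close>

lemma overlap_sq_has_max:
  assumes "finite A" "finite B"
  shows "\<exists>\<phi>A \<phi>B. normalized A \<phi>A \<and> normalized B \<phi>B \<and>
    (\<forall>\<phi>A' \<phi>B'. normalized A \<phi>A' \<longrightarrow> normalized B \<phi>B' \<longrightarrow>
      (cmod (braket Q (tensor A B \<phi>A' \<phi>B') \<psi>))\<^sup>2 \<le> (cmod (braket Q (tensor A B \<phi>A \<phi>B) \<psi>))\<^sup>2)"
proof -
  define K where "K Q = {\<phi>. normalized Q \<phi> \<and> (\<forall>x. x \<notin> basis Q \<longrightarrow> \<phi> x = 0)}" for Q
  define f where "f p = (cmod (braket Q (tensor A B (fst p) (snd p)) \<psi>))\<^sup>2" for p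
  have "compact (K A \<times> K B)"
    unfolding K_def using assms by (intro compact_Times compact_normalized_states)
  moreover have "K A \<times> K B \<noteq> {}"
    using ex_normalized[OF assms(1)] ex_normalized[OF assms(2)] by (auto simp: K_def)
  moreover have "continuous_on (K A \<times> K B) f"
  proof -
    have "continuous_on (K A \<times> K B) (\<lambda>p. fst p x)" "continuous_on (K A \<times> K B) (\<lambda>p. snd p x)" for x
      by (rule continuous_on_product_then_coordinatewise[OF continuous_on_fst[OF continuous_on_id]]
          continuous_on_product_then_coordinatewise[OF continuous_on_snd[OF continuous_on_id]])+
    then show ?thesis unfolding f_def braket_def tensor_def by (intro continuous_intros)
  qed
  ultimately obtain p where p: "p \<in> K A \<times> K B" "\<And>p'. p' \<in> K A \<times> K B \<Longrightarrow> f p' \<le> f p"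
    using continuous_attains_sup[of "K A \<times> K B" f] by blast
  have "(cmod (braket Q (tensor A B \<phi>A' \<phi>B') \<psi>))\<^sup>2 \<le> f p"
    if "normalized A \<phi>A'" "normalized B \<phi>B'" for \<phi>A' \<phi>B'
  proof -
    \<comment> \<open>Truncation moves any normalized state into the compact set and leaves the
      tensor product unchanged, since only restrictions are evaluated.\<close>
    define z where "z Q \<phi> = (\<lambda>x. if x \<in> basis Q then \<phi> x else 0)" for Q and \<phi> :: state
    have "(z A \<phi>A', z B \<phi>B') \<in> K A \<times> K B"
      using that by (auto simp: K_def z_def normalized_iff)
    moreover have "tensor A B (z A \<phi>A') (z B \<phi>B') = tensor A B \<phi>A' \<phi>B'"
      by (simp add: tensor_def z_def)
    ultimately show ?thesis using p(2)[of "(z A \<phi>A', z B \<phi>B')"] by (simp add: f_def)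
  qed
  moreover have "normalized A (fst p)" "normalized B (snd p)" using p(1) by (auto simp: K_def)
  ultimately show ?thesis unfolding f_def by blast
qed

text \<open>Attainment gives \<open>Greatest\<close> its value, so it can be used as a maximum from
  here on.\<close>

lemma alpha_part_greatest:
  assumes "(A, B) \<in> bipartitions n"
  shows "\<exists>\<phi>A \<phi>B. normalized A \<phi>A \<and> normalized B \<phi>B \<and>
      alpha_part n A B \<psi> = (cmod (braket {1..n} (tensor A B \<phi>A \<phi>B) \<psi>))\<^sup>2"
    and "normalized A \<phi>A \<Longrightarrow> normalized B \<phi>B \<Longrightarrow>
      (cmod (braket {1..n} (tensor A B \<phi>A \<phi>B) \<psi>))\<^sup>2 \<le> alpha_part n A B \<psi>"
proof -
  have "A \<union> B = {1..n}" using assms by (auto simp: bipartitions_def)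
  then have fin: "finite A" "finite B" by (metis finite_Un finite_atLeastAtMost)+
  let ?r = "\<lambda>\<phi>A \<phi>B. (cmod (braket {1..n} (tensor A B \<phi>A \<phi>B) \<psi>))\<^sup>2"
  obtain \<phi>A' \<phi>B' where *: "normalized A \<phi>A'" "normalized B \<phi>B'"
    "\<And>\<phi>A \<phi>B. normalized A \<phi>A \<Longrightarrow> normalized B \<phi>B \<Longrightarrow> ?r \<phi>A \<phi>B \<le> ?r \<phi>A' \<phi>B'"
    using overlap_sq_has_max[OF fin, of "{1..n}" \<psi>] by blast
  then have "alpha_part n A B \<psi> = ?r \<phi>A' \<phi>B'"
    unfolding alpha_part_def by (intro Greatest_equality) blast+
  with * show "\<exists>\<phi>A \<phi>B. normalized A \<phi>A \<and> normalized B \<phi>B \<and> alpha_part n A B \<psi> = ?r \<phi>A \<phi>B"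
    and "normalized A \<phi>A \<Longrightarrow> normalized B \<phi>B \<Longrightarrow> ?r \<phi>A \<phi>B \<le> alpha_part n A B \<psi>"
    by (metis, metis)
qed

lemma alpha_greatest:
  assumes "2 \<le> n"
  shows "\<exists>\<xi>. biseparable n \<xi> \<and> alpha n \<psi> = (cmod (braket {1..n} \<xi> \<psi>))\<^sup>2"
    and "biseparable n \<xi> \<Longrightarrow> (cmod (braket {1..n} \<xi> \<psi>))\<^sup>2 \<le> alpha n \<psi>"
proof -
  have fin: "finite (bipartitions n)"
    by (rule finite_subset[of _ "Pow {1..n} \<times> Pow {1..n}"]) (auto simp: bipartitions_def)
  \<comment> \<open>Two qubits are enough for a bipartition, so \<open>Max\<close> ranges over a
    nonempty finite set.\<close>
  have "({1}, {2..n}) \<in> bipartitions n" using assms by (auto simp: bipartitions_def)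
  then have "alpha n \<psi> \<in> (\<lambda>(A, B). alpha_part n A B \<psi>) ` bipartitions n"
    unfolding alpha_def using fin by (intro Max_in) auto
  then obtain A B where AB: "(A, B) \<in> bipartitions n" "alpha n \<psi> = alpha_part n A B \<psi>" by auto
  then show "\<exists>\<xi>. biseparable n \<xi> \<and> alpha n \<psi> = (cmod (braket {1..n} \<xi> \<psi>))\<^sup>2"
    using alpha_part_greatest(1)[OF AB(1), of \<psi>] unfolding biseparable_def by metis
  assume "biseparable n \<xi>"
  then obtain A B \<phi>A \<phi>B where bip: "(A, B) \<in> bipartitions n" and
    *: "normalized A \<phi>A" "normalized B \<phi>B" "\<xi> = tensor A B \<phi>A \<phi>B"
    unfolding biseparable_def by blast
  have "(cmod (braket {1..n} \<xi> \<psi>))\<^sup>2 \<le> alpha_part n A B \<psi>"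
    unfolding *(3) by (rule alpha_part_greatest(2)[OF bip *(1,2)])
  also have "\<dots> \<le> alpha n \<psi>"
    unfolding alpha_def using bip fin by (intro Max_ge) (auto intro: rev_image_eqI)
  finally show "(cmod (braket {1..n} \<xi> \<psi>))\<^sup>2 \<le> alpha n \<psi>" .
qed

section \<open>The value of \<alpha> for the hypergraph state\<close>

lemma alpha_H_state:
  assumes "3 \<le> n"
  shows "alpha n (H_state n) = overlap_cap n / 2 ^ n"
proof (rule antisym)
  have n: "2 \<le> n" using assms by simp
  show "alpha n (H_state n) \<le> overlap_cap n / 2 ^ n"
    using alpha_greatest(1)[OF n, of "H_state n"] overlap_sq_le_cap[OF _ assms]
    unfolding biseparable_def by metis
  show "overlap_cap n / 2 ^ n \<le> alpha n (H_state n)"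
    using overlap_cap_attained[OF assms] alpha_greatest(2)[OF n, of _ "H_state n"]
    unfolding biseparable_def by metis
qed

theorem mainTheorem1:
  fixes n :: nat
  assumes "n \<ge> 2"
  shows "(GREATEST r. \<exists>\<xi>. biseparable n \<xi> \<and> r = (cmod (braket {1..n} \<xi> (H_state n)))\<^sup>2)
           = alpha n (H_state n)
    \<and> alpha 4 (H_state 4) = (3 + sqrt 5) / 8
    \<and> (3 + sqrt 5) / 8 \<le> (3 / 4 :: real)
    \<and> (even n \<and> n \<ge> 6 \<longrightarrow> alpha n (H_state n) = (2 ^ (n - 1) - real n) / 2 ^ (n - 1))
    \<and> (odd n \<longrightarrow> alpha n (H_state n) = (2 ^ (n - 1) - real n + 1) / 2 ^ (n - 1))
    \<and> entanglement 4 (H_state 4) = (5 - sqrt 5) / 8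
    \<and> (5 - sqrt 5) / 8 \<ge> (1 / 4 :: real)
    \<and> (even n \<and> n \<ge> 6 \<longrightarrow> entanglement n (H_state n) = real n / 2 ^ (n - 1))
    \<and> (odd n \<longrightarrow> entanglement n (H_state n) = (real n - 1) / 2 ^ (n - 1))"
proof -
  have greatest: "(GREATEST r. \<exists>\<xi>. biseparable n \<xi> \<and> r = (cmod (braket {1..n} \<xi> (H_state n)))\<^sup>2)
      = alpha n (H_state n)"
    using alpha_greatest[OF assms] by (intro Greatest_equality) auto
  have four: "alpha 4 (H_state 4) = (3 + sqrt 5) / 8"
    by (simp add: alpha_H_state overlap_cap_def)
  \<comment> \<open>This gives both numerical inequalities, 3/4 and 1/4.\<close>
  have sqrt: "sqrt 5 \<le> 3" by (rule real_le_lsqrt) auto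
  obtain k where k: "n = Suc k" using assms by (cases n) auto
  have even: "alpha n (H_state n) = (2 ^ (n - 1) - real n) / 2 ^ (n - 1)" if "even n \<and> n \<ge> 6"
    using that k by (simp add: alpha_H_state overlap_cap_def field_simps)
  have odd: "alpha n (H_state n) = (2 ^ (n - 1) - real n + 1) / 2 ^ (n - 1)" if "odd n"
  proof -
    \<comment> \<open>Oddness excludes n = 2, which \<open>alpha_H_state\<close> does not
      cover.\<close>
    have "3 \<le> n" using that assms by presburger
    then show ?thesis using that k by (auto simp: alpha_H_state overlap_cap_def field_simps)
  qed
  show ?thesis
    using greatest four sqrt even odd by (auto simp: entanglement_def field_simps)
qed

end
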